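(* Let $m\ge 1$, $n\ge m$ be integers, let $X_1,\dots,X_n$ be i.i.d. real random variables with law $\mu$, and let $h:\mathbb{R}^m\to\mathbb{R}$ be a symmetric kernel which is centered, i.e. $\mathbb{E}[h(X_1,\dots,X_m)]=0$. Let $$U_n=\frac{1}{\binom{n}{m}}\sum_{1\le i_1<\dots<i_m\le n}h(X_{i_1},\dots,X_{i_m}),\qquad k=\lfloor n/m\rfloor ,$$ and let $I:[0,\infty)\to[0,\infty)$ be a non-decreasing function with $\mathbb{P}(h(X_1,\dots,X_m)>s)\le \exp(-I(s))$ for all $s\ge 0$. Then for every $0<\beta\le 1$ and every $t>0$, $$\mathbb{P}(U_n>t)\le \exp\left(-\frac{k t^2}{2\,v\left(kt,\beta\frac{I(kt)}{kt}\right)}\right)+\exp\left(-\beta I(kt)\max\left(\tfrac12,\,c(t,\beta,k)\right)\right)+\binom{n}{m}\exp(-I(kt)),$$ where $$c(t,\beta,k)=1-\frac{\beta}{2t}\,\frac{I(kt)}{kt}\,v\left(kt,\beta\frac{I(kt)}{kt}\right).$$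
   Context: Write $h$ for the random variable $h(X_1,\dots,X_m)$, and for $L\ge 0$ let $h_L=h\,\mathbf 1(h\le L)$ (the value $h$ is replaced by $0$ when $h>L$). For $L,\eta\ge 0$, $$v(L,\eta)=\mathbb{E}\left[h_L^2\,\mathbf 1(h\le 0)+h_L^2\exp(\eta h_L)\,\mathbf 1(h>0)\right]\in[0,\infty].$$ Conventions for degenerate values: if $v=\infty$ the first exponential equals $1$ and the maximum is $\tfrac12$; if $v=0$ the first exponential equals $0$. *)

theory Defs
  imports "HOL-Probability.Probability"
begin

text \<open>Points of \<open>\<real>\<^sup>m\<close> are the functions \<open>x \<in> {1..m} \<rightarrow>\<^sub>E UNIV\<close>, i.e. the elements of
  \<open>space (Pi\<^sub>M {1..m} (\<lambda>_. borel))\<close>, which are undefined outside \<open>{1..m}\<close>.\<close>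

text \<open>Composing with a permutation of \<open>{1..m}\<close> keeps \<open>x\<close> undefined outside \<open>{1..m}\<close>.\<close>

definition symmetric_kernel :: "nat \<Rightarrow> ((nat \<Rightarrow> real) \<Rightarrow> real) \<Rightarrow> bool" where
  "symmetric_kernel m h \<longleftrightarrow>
     (\<forall>p. p permutes {1..m} \<longrightarrow> (\<forall>x\<in>{1..m} \<rightarrow>\<^sub>E UNIV. h (x \<circ> p) = h x))"

definition increasing_tuples :: "nat \<Rightarrow> nat \<Rightarrow> (nat \<Rightarrow> nat) set" where
  "increasing_tuples m n = {i \<in> {1..m} \<rightarrow>\<^sub>E {1..n}. strict_mono_on {1..m} i}"

definition U_statistic ::
  "nat \<Rightarrow> nat \<Rightarrow> ((nat \<Rightarrow> real) \<Rightarrow> real) \<Rightarrow> (nat \<Rightarrow> 'a \<Rightarrow> real) \<Rightarrow> 'a \<Rightarrow> real" where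
  "U_statistic n m h X \<omega> =
     1 / real (n choose m) * (\<Sum>i\<in>increasing_tuples m n. h (\<lambda>j\<in>{1..m}. X (i j) \<omega>))"

definition kernel_rv :: "nat \<Rightarrow> ((nat \<Rightarrow> real) \<Rightarrow> real) \<Rightarrow> (nat \<Rightarrow> 'a \<Rightarrow> real) \<Rightarrow> 'a \<Rightarrow> real" where
  "kernel_rv m h X \<omega> = h (\<lambda>j\<in>{1..m}. X j \<omega>)"

text \<open>Values above \<open>L\<close> are replaced by \<open>0\<close>, not by \<open>L\<close>.\<close>

definition truncate_above :: "real \<Rightarrow> real \<Rightarrow> real" where
  "truncate_above L y = y * indicator {..L} y"

definition truncated_moment :: "'a measure \<Rightarrow> ('a \<Rightarrow> real) \<Rightarrow> real \<Rightarrow> real \<Rightarrow> ennreal" where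
  "truncated_moment M H L \<eta> =
     (\<integral>\<^sup>+\<omega>. ennreal
        ((truncate_above L (H \<omega>))\<^sup>2 * indicator {..0} (H \<omega>)
         + (truncate_above L (H \<omega>))\<^sup>2 * exp (\<eta> * truncate_above L (H \<omega>)) * indicator {0<..} (H \<omega>))
      \<partial>M)"

text \<open>Below, \<open>v\<close> is a value of \<^const>\<open>truncated_moment\<close>, whose degenerate values are
  separate cases, and \<open>J\<close> is \<open>I (k t)\<close>.\<close>

definition gaussian_term :: "nat \<Rightarrow> real \<Rightarrow> ennreal \<Rightarrow> real" where
  "gaussian_term k t v =
     (if v = \<infinity> then 1 else if v = 0 then 0
      else exp (- (real k * t\<^sup>2 / (2 * enn2real v))))"

definition c_coeff :: "real \<Rightarrow> real \<Rightarrow> nat \<Rightarrow> real \<Rightarrow> real \<Rightarrow> real" where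
  "c_coeff t \<beta> k J v = 1 - \<beta> / (2 * t) * (J / (real k * t)) * v"

definition max_half_c :: "real \<Rightarrow> real \<Rightarrow> nat \<Rightarrow> real \<Rightarrow> ennreal \<Rightarrow> real" where
  "max_half_c t \<beta> k J v =
     (if v = \<infinity> then 1 / 2 else max (1 / 2) (c_coeff t \<beta> k J (enn2real v)))"

end

theory Submission
  imports Defs
begin

text \<open>The bound is Chernoff's inequality for a truncated kernel. Put \<open>L = k t\<close> and
  \<open>\<eta> = \<beta> I(L) / L\<close>, and let \<open>h\<^sub>L\<close> be the kernel with the values above \<open>L\<close> replaced by \<open>0\<close>.

  If no summand of \<open>U\<^sub>n\<close> exceeds \<open>L\<close>, then \<open>U\<^sub>n\<close> coincides with the U-statistic of \<open>h\<^sub>L\<close>. Each of the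
  \<open>n choose m\<close> summands has the law of \<open>h(X\<^sub>1, ..., X\<^sub>m)\<close>, so a union bound charges
  \<open>(n choose m) exp (- I L)\<close> for the complementary event
  (\<open>prob_U_statistic_le_truncated\<close>).

  For the U-statistic of \<open>h\<^sub>L\<close> the summands are dependent. Hoeffding's device is to write it as the
  average, over the permutations \<open>p\<close> of \<open>{1..n}\<close>, of the mean of \<open>k\<close> kernel values on the disjoint
  blocks \<open>p {1..m}, p {m+1..2m}, ...\<close>; for a fixed \<open>p\<close> these are independent. By convexity of
  \<open>exp\<close>, the moment generating function at \<open>l k\<close> is then at most the \<open>k\<close>-th power of
  \<open>E (exp (l h\<^sub>L))\<close> (\<open>U_statistic_mgf_le\<close>).

  Since \<open>exp x \<le> 1 + x + x\<^sup>2/2 max 1 (exp x)\<close> and \<open>E h\<^sub>L \<le> E h = 0\<close>, that expectation is at most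
  \<open>exp (l\<^sup>2 v / 2)\<close> whenever \<open>0 \<le> l \<le> \<eta>\<close>, where \<open>v = v(L, \<eta>)\<close> (\<open>mgf_truncate_above_le\<close>). Hence the
  truncated tail is at most \<open>exp (- k (l t - l\<^sup>2 v / 2))\<close>. The exponent is best at \<open>l = t / v\<close>; this
  choice is admissible if \<open>t / v \<le> \<eta>\<close> and gives the Gaussian term. Otherwise \<open>l = \<eta>\<close> gives the
  second term, because \<open>k t \<eta> = \<beta> I(L)\<close>, and \<open>\<eta> v \<le> t\<close> makes the coefficient \<open>c\<close> at least \<open>1/2\<close>
  (\<open>Chernoff_exponent_choice\<close>). For \<open>v = 0\<close> only the second choice occurs, and for \<open>v = \<infinity>\<close> the
  Gaussian term is \<open>1\<close>, so that the bound is trivial.\<close>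

section \<open>Averages over permutations and over subsets\<close>

lemma permutes_mapping_subset_onto:
  assumes "finite A" "B \<subseteq> A" "C \<subseteq> A" "card B = card C"
  obtains p where "p permutes A" "p ` B = C"
proof -
  have fin: "finite B" "finite C" "finite (A - B)" "finite (A - C)"
    using assms by (auto intro: finite_subset)
  obtain f where f: "bij_betw f B C"
    using finite_same_card_bij[OF fin(1,2) assms(4)] by blast
  have "card (A - B) = card (A - C)"
    using assms fin by (simp add: card_Diff_subset)
  then obtain g where g: "bij_betw g (A - B) (A - C)"
    using finite_same_card_bij[OF fin(3,4)] by blast
  have "bij_betw (\<lambda>x. if x \<in> B then f x else g x) (B \<union> (A - B)) (C \<union> (A - C))"
    by (rule bij_betw_disjoint_Un[OF f g]) auto
  then have "bij_betw (\<lambda>x. if x \<in> B then f x else g x) A A"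
    using assms by (simp add: Un_absorb1)
  then have "restrict_id (\<lambda>x. if x \<in> B then f x else g x) A permutes A"
    by (rule permutes_restrict_id)
  moreover have "restrict_id (\<lambda>x. if x \<in> B then f x else g x) A ` B = C"
    using f assms by (auto simp: bij_betw_def image_iff subset_iff)
  ultimately show thesis by (rule that)
qed

text \<open>The sum over all subsets of a given size is invariant under every permutation of \<open>A\<close>. Averaging
  it over the permutations and exchanging the sums makes the contribution of each subset an orbit sum,
  and the orbit sums agree because permutations act transitively on subsets of equal size. This avoids
  counting the permutations that map \<open>B\<close> onto a given set.\<close>

lemma permutation_average_eq_subset_average:
  fixes G :: "'b set \<Rightarrow> real"
  assumes "finite A" "B \<subseteq> A"
  shows "(\<Sum>p | p permutes A. G (p ` B)) / fact (card A)
       = (\<Sum>S | S \<subseteq> A \<and> card S = card B. G S) / real (card A choose card B)"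
proof -
  let ?P = "{p. p permutes A}" and ?T = "{S. S \<subseteq> A \<and> card S = card B}"
  have invariant: "(\<Sum>S\<in>?T. G (p ` S)) = (\<Sum>S\<in>?T. G S)" if p: "p permutes A" for p
  proof -
    have "bij_betw (\<lambda>S. p ` S) ?T ?T"
    proof (rule bij_betw_byWitness[where f' = "\<lambda>S. inv p ` S"])
      show "\<forall>S\<in>?T. inv p ` p ` S = S" "\<forall>S\<in>?T. p ` inv p ` S = S"
        using permutes_inv_o[OF p] by (auto simp: image_comp)
      show "(\<lambda>S. p ` S) ` ?T \<subseteq> ?T"
        using permutes_image[OF p] permutes_inj[OF p]
        by (auto simp: card_image inj_on_subset dest: subsetD)
      show "(\<lambda>S. inv p ` S) ` ?T \<subseteq> ?T"
        using permutes_image[OF permutes_inv[OF p]] permutes_inj[OF permutes_inv[OF p]]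
        by (auto simp: card_image inj_on_subset dest: subsetD)
    qed
    then show ?thesis by (rule sum.reindex_bij_betw)
  qed
  have transitive: "(\<Sum>p\<in>?P. G (p ` S)) = (\<Sum>p\<in>?P. G (p ` B))" if "S \<in> ?T" for S
  proof -
    obtain q where q: "q permutes A" "q ` B = S"
      using permutes_mapping_subset_onto[of A B S] assms \<open>S \<in> ?T\<close> by auto
    have "(\<Sum>p\<in>?P. G (p ` B)) = (\<Sum>p\<in>?P. G ((p \<circ> q) ` B))"
      by (rule sum_permutations_compose_right[OF q(1)])
    also have "\<dots> = (\<Sum>p\<in>?P. G (p ` S))"
      by (simp add: q(2)[symmetric] image_image)
    finally show ?thesis by simp
  qed
  have cards: "card ?P = fact (card A)" "card ?T = (card A choose card B)"
    using assms by (auto simp: card_permutations n_subsets)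
  have pos: "(card A choose card B) > 0"
    using assms by (simp add: card_mono)
  have "fact (card A) * (\<Sum>S\<in>?T. G S) = (\<Sum>p\<in>?P. \<Sum>S\<in>?T. G (p ` S))"
    using invariant cards(1) by simp
  also have "\<dots> = (\<Sum>S\<in>?T. \<Sum>p\<in>?P. G (p ` S))"
    by (rule sum.swap)
  also have "\<dots> = real (card A choose card B) * (\<Sum>p\<in>?P. G (p ` B))"
    using transitive cards(2) by simp
  finally show ?thesis using pos by (simp add: field_simps)
qed

section \<open>U-statistics as averages over permutations\<close>

text \<open>Two injective enumerations of the same set differ by a permutation of the positions. It is
  extended by the identity so that composing with it keeps the value \<open>undefined\<close> outside
  \<open>{1..m}\<close>.\<close>

lemma symmetric_kernel_eq_if_same_image:
  fixes h :: "(nat \<Rightarrow> real) \<Rightarrow> real"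
  assumes sym: "symmetric_kernel m h"
    and f: "inj_on f {1..m}" and g: "inj_on g {1..m}" and img: "f ` {1..m} = g ` {1..m}"
  shows "h (\<lambda>j\<in>{1..m}. x (f j)) = h (\<lambda>j\<in>{1..m}. x (g j))"
proof -
  have bf: "bij_betw f {1..m} (g ` {1..m})" and bg: "bij_betw g {1..m} (g ` {1..m})"
    using f g img by (auto simp: bij_betw_def)
  define p where "p = restrict_id (inv_into {1..m} g \<circ> f) {1..m}"
  have "p permutes {1..m}"
    unfolding p_def
    by (intro permutes_restrict_id bij_betw_trans[OF bf] bij_betw_inv_into bg)
  moreover have "(\<lambda>j\<in>{1..m}. x (g j)) \<circ> p = (\<lambda>j\<in>{1..m}. x (f j))"
  proof
    fix j
    have "inv_into {1..m} g (f j) \<in> {1..m}" "g (inv_into {1..m} g (f j)) = f j"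
      if "j \<in> {1..m}"
      using that img by (metis imageI inv_into_into, metis f_inv_into_f imageI)
    then show "((\<lambda>j\<in>{1..m}. x (g j)) \<circ> p) j = (\<lambda>j\<in>{1..m}. x (f j)) j"
      by (auto simp: p_def restrict_id_def)
  qed
  ultimately show ?thesis
    using sym unfolding symmetric_kernel_def by (metis restrict_PiE_iff UNIV_I)
qed

text \<open>An increasing tuple is the sorted list of its values, and sorted lists without repetition are
  determined by their sets of entries.\<close>

lemma bij_betw_increasing_tuples_subsets:
  "bij_betw (\<lambda>i. i ` {1..m}) (increasing_tuples m n) {S. S \<subseteq> {1..n} \<and> card S = m}"
  unfolding bij_betw_def
proof
  let ?l = "\<lambda>i::nat\<Rightarrow>nat. map i [1..<Suc m]"
  have sorted: "sorted_wrt (<) (?l i)" if "i \<in> increasing_tuples m n" for i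
    using that unfolding increasing_tuples_def strict_mono_on_def
    by (auto simp: sorted_wrt_iff_nth_less simp del: upt_Suc)
  show "inj_on (\<lambda>i. i ` {1..m}) (increasing_tuples m n)"
  proof (rule inj_onI)
    fix i i' assume i: "i \<in> increasing_tuples m n" and i': "i' \<in> increasing_tuples m n"
      and "i ` {1..m} = i' ` {1..m}"
    then have "set (?l i') = set (?l i)"
      by (simp add: atLeastLessThanSuc_atLeastAtMost del: upt_Suc)
    then have "?l i' = ?l i"
      by (rule strict_sorted_equal[OF sorted[OF i] sorted[OF i']])
    then have "\<forall>j\<in>{1..m}. i j = i' j"
      by (auto simp del: upt_Suc)
    with i i' show "i = i'"
      unfolding increasing_tuples_def by (auto intro: PiE_ext)
  qed
  show "(\<lambda>i. i ` {1..m}) ` increasing_tuples m n = {S. S \<subseteq> {1..n} \<and> card S = m}"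
  proof (intro equalityI subsetI)
    fix S assume "S \<in> (\<lambda>i. i ` {1..m}) ` increasing_tuples m n"
    then show "S \<in> {S. S \<subseteq> {1..n} \<and> card S = m}"
      unfolding increasing_tuples_def
      by (auto simp: card_image strict_mono_on_imp_inj_on)
  next
    fix S assume S: "S \<in> {S. S \<subseteq> {1..n} \<and> card S = m}"
    then have "finite S" by (auto intro: finite_subset)
    define l where "l = sorted_list_of_set S"
    have l: "set l = S" "length l = m" "sorted_wrt (<) l"
      using S \<open>finite S\<close> by (auto simp: l_def strict_sorted_list_of_set)
    let ?i = "\<lambda>j\<in>{1..m}. l ! (j - 1)"
    have img: "?i ` {1..m} = S"
    proof -
      have "?i ` {1..m} = (\<lambda>j. l ! (j - 1)) ` {1..m}" by (intro image_cong) auto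
      also have "\<dots> = (\<lambda>j. l ! (j - 1)) ` Suc ` {0..<m}"
        by (simp add: atLeastLessThanSuc_atLeastAtMost)
      also have "\<dots> = (!) l ` {0..<m}"
        unfolding image_image by simp
      also have "\<dots> = S" using l nth_image[of m l] by (simp add: atLeast0LessThan)
      finally show ?thesis .
    qed
    moreover have "?i \<in> increasing_tuples m n"
      unfolding increasing_tuples_def
      using S img l sorted_wrt_nth_less[OF l(3)]
      by (auto simp: strict_mono_on_def)
    ultimately show "S \<in> (\<lambda>i. i ` {1..m}) ` increasing_tuples m n"
      by blast
  qed
qed

lemma increasing_tuplesD:
  assumes "i \<in> increasing_tuples m n"
  shows "inj_on i {1..m}" "i ` {1..m} \<subseteq> {1..n}"
  using assms unfolding increasing_tuples_def by (auto simp: strict_mono_on_imp_inj_on)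

lemma finite_increasing_tuples: "finite (increasing_tuples m n)"
  using bij_betw_finite[OF bij_betw_increasing_tuples_subsets[of m n]] by simp

lemma card_increasing_tuples: "card (increasing_tuples m n) = n choose m"
  using bij_betw_same_card[OF bij_betw_increasing_tuples_subsets[of m n]]
  by (simp add: n_subsets)

text \<open>By symmetry a kernel value depends only on the set of indices used, so the U-statistic is an
  average over subsets. The tuple \<open>f\<close> is arbitrary, which allows a different one for each of the
  disjoint blocks below.\<close>

lemma U_statistic_eq_permutation_average:
  assumes sym: "symmetric_kernel m h"
    and f: "inj_on f {1..m}" "f ` {1..m} \<subseteq> {1..n}"
  shows "U_statistic n m h X \<omega>
       = (\<Sum>p | p permutes {1..n}. h (\<lambda>j\<in>{1..m}. X (p (f j)) \<omega>)) / fact n"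
proof -
  define H where "H = (\<lambda>f. h (\<lambda>j\<in>{1..m}. X (f j) \<omega>))"
  \<comment> \<open>the kernel as a function of index sets; the enumeration chosen is immaterial by symmetry\<close>
  define G where "G = (\<lambda>S. H (SOME f. bij_betw f {1..m} S))"
  have G: "G (g ` {1..m}) = H g" if g: "inj_on g {1..m}" for g
  proof -
    define g' where "g' = (SOME f. bij_betw f {1..m} (g ` {1..m}))"
    have "bij_betw g' {1..m} (g ` {1..m})"
      unfolding g'_def by (rule someI[of _ g]) (rule inj_on_imp_bij_betw[OF g])
    then show ?thesis
      unfolding G_def H_def g'_def[symmetric]
      using symmetric_kernel_eq_if_same_image[OF sym _ g] by (auto simp: bij_betw_def)
  qed
  have cf: "card (f ` {1..m}) = m"
    using f(1) by (simp add: card_image)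
  have "U_statistic n m h X \<omega> = (\<Sum>i\<in>increasing_tuples m n. G (i ` {1..m})) / real (n choose m)"
    unfolding U_statistic_def H_def[symmetric]
    using G increasing_tuplesD(1) by (simp add: H_def cong: sum.cong)
  also have "(\<Sum>i\<in>increasing_tuples m n. G (i ` {1..m})) = (\<Sum>S | S \<subseteq> {1..n} \<and> card S = m. G S)"
    by (rule sum.reindex_bij_betw[OF bij_betw_increasing_tuples_subsets])
  also have "\<dots> / real (n choose m) = (\<Sum>p | p permutes {1..n}. G (p ` f ` {1..m})) / fact n"
    using permutation_average_eq_subset_average[OF _ f(2), of G] cf by simp
  also have "(\<Sum>p | p permutes {1..n}. G (p ` f ` {1..m})) = (\<Sum>p | p permutes {1..n}. H (p \<circ> f))"
  proof (rule sum.cong[OF refl])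
    fix p assume "p \<in> {p. p permutes {1..n}}"
    then have "inj_on (p \<circ> f) {1..m}"
      using f(1) by (auto intro!: comp_inj_on intro: inj_on_subset dest: permutes_inj)
    from G[OF this] show "G (p ` f ` {1..m}) = H (p \<circ> f)" by (simp add: image_comp)
  qed
  finally show ?thesis by (simp add: H_def)
qed

section \<open>Kernels evaluated on subfamilies of an i.i.d. family\<close>

lemma (in prob_space) iid_subfamily_distr:
  assumes indep: "indep_vars (\<lambda>_. borel) X A"
    and ident: "\<And>i. i \<in> A \<Longrightarrow> distr M borel (X i) = \<mu>"
    and f: "inj_on f J" "f ` J \<subseteq> A" and "J \<noteq> {}"
  shows "distr M (Pi\<^sub>M J (\<lambda>_. borel)) (\<lambda>\<omega>. \<lambda>j\<in>J. X (f j) \<omega>) = (\<Pi>\<^sub>M j\<in>J. \<mu>)"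
proof -
  have "indep_vars (\<lambda>j. Pi\<^sub>M {f j} (\<lambda>_. borel)) (\<lambda>j \<omega>. \<lambda>i\<in>{f j}. X i \<omega>) J"
    using f by (intro indep_vars_restrict[OF indep]) (auto simp: disjoint_family_on_def inj_on_def)
  then have "indep_vars (\<lambda>_. borel) (\<lambda>j \<omega>. (\<lambda>i\<in>{f j}. X i \<omega>) (f j)) J"
    by (rule indep_vars_compose2[where Y = "\<lambda>j y. y (f j)"]) auto
  then have "indep_vars (\<lambda>_. borel) (\<lambda>j. X (f j)) J" by simp
  moreover have "random_variable borel (X (f j))" if "j \<in> J" for j
    using indep f(2) that by (auto simp: indep_vars_def)
  ultimately have "distr M (Pi\<^sub>M J (\<lambda>_. borel)) (\<lambda>\<omega>. \<lambda>j\<in>J. X (f j) \<omega>)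
      = (\<Pi>\<^sub>M j\<in>J. distr M borel (X (f j)))"
    using indep_vars_iff_distr_eq_PiM'[OF \<open>J \<noteq> {}\<close>, of "\<lambda>j. X (f j)" "\<lambda>_. borel"] by simp
  also have "\<dots> = (\<Pi>\<^sub>M j\<in>J. \<mu>)"
    using f(2) by (intro PiM_cong) (auto intro!: ident)
  finally show ?thesis .
qed

lemma (in prob_space) measurable_subfamily:
  assumes "indep_vars (\<lambda>_. N) X A" and "f ` J \<subseteq> A"
  shows "(\<lambda>\<omega>. \<lambda>j\<in>J. X (f j) \<omega>) \<in> measurable M (Pi\<^sub>M J (\<lambda>_. N))"
  using assms by (intro measurable_restrict) (auto simp: indep_vars_def)

lemma (in prob_space) kernel_of_iid_subfamily_distr:
  assumes indep: "indep_vars (\<lambda>_. borel) X A"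
    and ident: "\<And>i. i \<in> A \<Longrightarrow> distr M borel (X i) = \<mu>"
    and h: "h \<in> borel_measurable (Pi\<^sub>M J (\<lambda>_. borel))"
    and f: "inj_on f J" "f ` J \<subseteq> A" and "J \<noteq> {}"
  shows "distr M borel (\<lambda>\<omega>. h (\<lambda>j\<in>J. X (f j) \<omega>)) = distr (\<Pi>\<^sub>M j\<in>J. \<mu>) borel h"
proof -
  have "distr M borel (\<lambda>\<omega>. h (\<lambda>j\<in>J. X (f j) \<omega>))
      = distr (distr M (Pi\<^sub>M J (\<lambda>_. borel)) (\<lambda>\<omega>. \<lambda>j\<in>J. X (f j) \<omega>)) borel h"
    by (subst distr_distr[OF h measurable_subfamily[OF indep f(2)]]) (simp add: comp_def)
  also have "\<dots> = distr (\<Pi>\<^sub>M j\<in>J. \<mu>) borel h"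
    by (subst iid_subfamily_distr[OF indep ident f \<open>J \<noteq> {}\<close>]) auto
  finally show ?thesis .
qed

text \<open>Kernel values on disjoint blocks are functions of the restrictions of \<open>X\<close> to disjoint index
  sets. The restriction is indexed by \<open>f b ` J\<close>, so the function that is applied to it first
  reindexes to \<open>J\<close>.\<close>

lemma (in prob_space) indep_vars_disjoint_blocks:
  assumes indep: "indep_vars (\<lambda>_. N) X A"
    and f: "\<And>b. b \<in> B \<Longrightarrow> f b ` J \<subseteq> A" "disjoint_family_on (\<lambda>b. f b ` J) B"
    and h: "h \<in> measurable (Pi\<^sub>M J (\<lambda>_. N)) N'"
  shows "indep_vars (\<lambda>_. N') (\<lambda>b \<omega>. h (\<lambda>j\<in>J. X (f b j) \<omega>)) B"
proof -
  have "indep_vars (\<lambda>b. N') (\<lambda>b \<omega>. h (\<lambda>j\<in>J. (\<lambda>i\<in>f b ` J. X i \<omega>) (f b j))) B"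
    by (rule indep_vars_compose2[OF indep_vars_restrict[OF indep f],
          where Y = "\<lambda>b y. h (\<lambda>j\<in>J. y (f b j))"])
      (auto intro!: measurable_compose[OF measurable_restrict h] measurable_component_singleton
        simp del: restrict_apply)
  then show ?thesis
    by (simp cong: restrict_cong)
qed

lemma (in prob_space) measurable_U_statistic:
  assumes indep: "indep_vars (\<lambda>_. borel) X {1..n}"
    and h: "h \<in> borel_measurable (Pi\<^sub>M {1..m} (\<lambda>_. borel))"
  shows "random_variable borel (U_statistic n m h X)"
proof -
  have "random_variable borel (\<lambda>\<omega>. h (\<lambda>j\<in>{1..m}. X (i j) \<omega>))" if "i \<in> increasing_tuples m n" for i
    using measurable_compose[OF measurable_subfamily[OF indep increasing_tuplesD(2)[OF that]] h] .
  then show ?thesis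
    unfolding U_statistic_def[abs_def]
    by (intro borel_measurable_times borel_measurable_sum borel_measurable_const)
qed

section \<open>The moment generating function of a U-statistic\<close>

lemma exp_average_le_average_exp:
  fixes y :: "'b \<Rightarrow> real"
  assumes "finite S" "S \<noteq> {}"
  shows "exp ((\<Sum>i\<in>S. y i) / real (card S)) \<le> (\<Sum>i\<in>S. exp (y i)) / real (card S)"
proof -
  have "exp (\<Sum>i\<in>S. (1 / real (card S)) *\<^sub>R y i) \<le> (\<Sum>i\<in>S. 1 / real (card S) * exp (y i))"
    using assms by (intro convex_on_sum[OF _ _ exp_convex]) auto
  then show ?thesis
    by (simp add: sum_divide_distrib)
qed

text \<open>Hoeffding's reduction to independent summands: \<open>k\<close> times the U-statistic is an average of
  sums of \<open>k\<close> independent kernel values, and Jensen's inequality moves the average out of the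
  exponential.\<close>

lemma (in prob_space) U_statistic_mgf_le:
  assumes "1 \<le> m"
    and indep: "indep_vars (\<lambda>_. borel) X {1..n}"
    and ident: "\<And>i. i \<in> {1..n} \<Longrightarrow> distr M borel (X i) = \<mu>"
    and h[measurable]: "h \<in> borel_measurable (Pi\<^sub>M {1..m} (\<lambda>_. borel))"
    and sym: "symmetric_kernel m h"
    and kmn: "k * m \<le> n" and "1 \<le> k"
    and int: "integrable M (\<lambda>\<omega>. exp (l * kernel_rv m h X \<omega>))"
  shows "integrable M (\<lambda>\<omega>. exp (l * real k * U_statistic n m h X \<omega>))"
    and "expectation (\<lambda>\<omega>. exp (l * real k * U_statistic n m h X \<omega>))
           \<le> expectation (\<lambda>\<omega>. exp (l * kernel_rv m h X \<omega>)) ^ k"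
proof -
  let ?P = "{p. p permutes {1..n}}"
  let ?E = "expectation (\<lambda>\<omega>. exp (l * kernel_rv m h X \<omega>))"
  define H where "H = (\<lambda>f \<omega>. h (\<lambda>j\<in>{1..m}. X (f j) \<omega>))"
  define block where "block = (\<lambda>b j. b * m + j)"
  have block_range: "block b ` {1..m} \<subseteq> {1..n}" if "b < k" for b
  proof -
    have "(b + 1) * m \<le> k * m" using that by (intro mult_right_mono) auto
    then show ?thesis using kmn by (auto simp: block_def)
  qed
  have block_inj: "inj_on (block b) {1..m}" for b
    by (auto simp: block_def inj_on_def)
  have block_disjoint: "b = b'" if "block b j = block b' j'" "j \<in> {1..m}" "j' \<in> {1..m}" for b b' j j'
  proof -
    \<comment> \<open>the shift by one is needed because positions run from \<open>1\<close> to \<open>m\<close>\<close>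
    have div: "(c * m + i - 1) div m = c" if "i \<in> {1..m}" for c i
      using that by (cases i) auto
    show ?thesis using div[of j b] div[of j' b'] that by (simp add: block_def)
  qed
  have perm_block: "(p \<circ> block b) ` {1..m} \<subseteq> {1..n}" "inj_on (p \<circ> block b) {1..m}"
    if "p \<in> ?P" "b < k" for p b
    using that block_range[OF that(2)] block_inj[of b] permutes_image[of p "{1..n}"]
    by (auto simp: image_comp[symmetric] simp del: image_comp
        intro!: comp_inj_on intro: inj_on_subset dest: permutes_inj)
  have H_measurable: "random_variable borel (H f)" if "f ` {1..m} \<subseteq> {1..n}" for f
    unfolding H_def using measurable_compose[OF measurable_subfamily[OF indep that] h] .
  have H_law: "distr M borel (H f) = distr (\<Pi>\<^sub>M j\<in>{1..m}. \<mu>) borel h"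
    if f: "f ` {1..m} \<subseteq> {1..n}" "inj_on f {1..m}" for f
    unfolding H_def using \<open>1 \<le> m\<close>
    by (intro kernel_of_iid_subfamily_distr[OF indep ident h f(2,1)]) auto
  have kernel: "kernel_rv m h X = H id"
    by (simp add: kernel_rv_def H_def fun_eq_iff)
  have "m \<le> k * m" using \<open>1 \<le> k\<close> by (cases k) auto
  with kmn have "m \<le> n" by (rule order_trans[rotated])
  then have "id ` {1..m} \<subseteq> {1..n}" by simp
  then have id_m: "random_variable borel (H id)" "distr M borel (H id) = distr (\<Pi>\<^sub>M j\<in>{1..m}. \<mu>) borel h"
    using H_measurable H_law by auto
  have H_mgf: "integrable M (\<lambda>\<omega>. exp (l * H f \<omega>))" "expectation (\<lambda>\<omega>. exp (l * H f \<omega>)) = ?E"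
    if f: "f ` {1..m} \<subseteq> {1..n}" "inj_on f {1..m}" for f
  proof -
    have same: "distr M borel (H f) = distr M borel (H id)"
      using H_law[OF f] id_m by simp
    have "integrable (distr M borel (H f)) (\<lambda>y. exp (l * y))"
      unfolding same using int id_m(1) by (subst integrable_distr_eq) (auto simp: kernel)
    then show "integrable M (\<lambda>\<omega>. exp (l * H f \<omega>))"
      using H_measurable[OF f(1)] by (subst (asm) integrable_distr_eq) auto
    have "expectation (\<lambda>\<omega>. exp (l * H f \<omega>)) = (\<integral>y. exp (l * y) \<partial>distr M borel (H f))"
      using H_measurable[OF f(1)] by (subst integral_distr) auto
    also have "\<dots> = ?E"
      unfolding same using id_m(1) by (subst integral_distr) (auto simp: kernel)
    finally show "expectation (\<lambda>\<omega>. exp (l * H f \<omega>)) = ?E" .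
  qed
  \<comment> \<open>for each fixed permutation, a sum of independent terms\<close>
  define W where "W = (\<lambda>p \<omega>. \<Sum>b<k. H (p \<circ> block b) \<omega>)"
  have W_mgf: "integrable M (\<lambda>\<omega>. exp (l * W p \<omega>))" "expectation (\<lambda>\<omega>. exp (l * W p \<omega>)) = ?E ^ k"
    if p: "p \<in> ?P" for p
  proof -
    have "disjoint_family_on (\<lambda>b. (p \<circ> block b) ` {1..m}) {..<k}"
      unfolding disjoint_family_on_def
    proof (intro ballI impI)
      fix b b' :: nat assume "b \<noteq> b'"
      moreover have "block b j = block b' j'" if "p (block b j) = p (block b' j')" for j j'
        using permutes_inj[of p] p that by (auto dest: injD)
      ultimately show "(p \<circ> block b) ` {1..m} \<inter> (p \<circ> block b') ` {1..m} = {}"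
        using block_disjoint by fastforce
    qed
    then have "indep_vars (\<lambda>_. borel) (\<lambda>b. H (p \<circ> block b)) {..<k}"
      unfolding H_def using perm_block(1)[OF p]
      by (intro indep_vars_disjoint_blocks[OF indep _ _ h]) auto
    then have ind: "indep_vars (\<lambda>_. borel) (\<lambda>b \<omega>. exp (l * H (p \<circ> block b) \<omega>)) {..<k}"
      by (rule indep_vars_compose2) auto
    have prod: "exp (l * W p \<omega>) = (\<Prod>b<k. exp (l * H (p \<circ> block b) \<omega>))" for \<omega>
      by (simp add: W_def sum_distrib_left exp_sum)
    note mgf = H_mgf[OF perm_block[OF p]]
    show "integrable M (\<lambda>\<omega>. exp (l * W p \<omega>))"
      unfolding prod using mgf(1) by (intro indep_vars_integrable[OF _ ind]) auto
    show "expectation (\<lambda>\<omega>. exp (l * W p \<omega>)) = ?E ^ k"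
      unfolding prod using mgf by (subst indep_vars_lebesgue_integral[OF _ ind]) auto
  qed
  have U: "real k * U_statistic n m h X \<omega> = (\<Sum>p\<in>?P. W p \<omega>) / fact n" for \<omega>
  proof -
    have "real k * U_statistic n m h X \<omega> = (\<Sum>b<k. U_statistic n m h X \<omega>)" by simp
    also have "\<dots> = (\<Sum>b<k. (\<Sum>p\<in>?P. H (p \<circ> block b) \<omega>) / fact n)"
      using U_statistic_eq_permutation_average[OF sym block_inj block_range]
      by (intro sum.cong) (auto simp: H_def)
    also have "\<dots> = (\<Sum>p\<in>?P. W p \<omega>) / fact n"
      unfolding W_def by (subst sum.swap) (simp add: sum_divide_distrib)
    finally show ?thesis .
  qed
  have card_P: "card ?P = fact n" and fin_P: "finite ?P"
    by (auto simp: card_permutations finite_permutations)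
  have nonempty: "?P \<noteq> {}" using permutes_id by blast
  have jensen: "exp (l * real k * U_statistic n m h X \<omega>) \<le> (\<Sum>p\<in>?P. exp (l * W p \<omega>)) / fact n" for \<omega>
  proof -
    have "l * real k * U_statistic n m h X \<omega> = (\<Sum>p\<in>?P. l * W p \<omega>) / fact n"
      by (simp only: mult.assoc U sum_distrib_left times_divide_eq_right)
    then show ?thesis
      using exp_average_le_average_exp[OF fin_P nonempty, of "\<lambda>p. l * W p \<omega>"]
      by (simp only: card_P of_nat_fact)
  qed
  have int_avg: "integrable M (\<lambda>\<omega>. (\<Sum>p\<in>?P. exp (l * W p \<omega>)) / fact n)"
    using W_mgf(1) by (intro integrable_divide integrable_sum) auto
  have [measurable]: "random_variable borel (U_statistic n m h X)"
    by (rule measurable_U_statistic[OF indep h])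
  show int_U: "integrable M (\<lambda>\<omega>. exp (l * real k * U_statistic n m h X \<omega>))"
    using jensen by (intro Bochner_Integration.integrable_bound[OF int_avg]) (auto simp: sum_nonneg)
  have "expectation (\<lambda>\<omega>. exp (l * real k * U_statistic n m h X \<omega>))
      \<le> expectation (\<lambda>\<omega>. (\<Sum>p\<in>?P. exp (l * W p \<omega>)) / fact n)"
    by (rule integral_mono[OF int_U int_avg jensen])
  also have "\<dots> = (\<Sum>p\<in>?P. ?E ^ k) / fact n"
    using W_mgf by (simp add: Bochner_Integration.integral_sum)
  also have "\<dots> = ?E ^ k" by (simp only: sum_constant card_P of_nat_fact) simp
  finally show "expectation (\<lambda>\<omega>. exp (l * real k * U_statistic n m h X \<omega>)) \<le> ?E ^ k" .
qed

section \<open>The moment generating function of a truncated variable\<close>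

text \<open>Taylor's formula with the second derivative \<open>exp\<close> at an intermediate point: it is at most \<open>1\<close>
  for negative \<open>x\<close> and at most \<open>exp x\<close> for positive \<open>x\<close>.\<close>

lemma exp_le_quadratic:
  fixes x :: real
  shows "exp x \<le> 1 + x + x\<^sup>2 / 2 * max 1 (exp x)"
proof (cases "x \<le> 0")
  case True
  \<comment> \<open>the fact used for positive \<open>x\<close> only places the intermediate point in \<open>[-\<bar>x\<bar>, \<bar>x\<bar>]\<close>, where
    \<open>exp\<close> may exceed \<open>1\<close>; monotonicity of the remainder replaces it\<close>
  have "exp 0 - 1 - 0 - 0\<^sup>2 / 2 \<ge> exp x - 1 - x - x\<^sup>2 / 2"
  proof (rule DERIV_nonneg_imp_nondecreasing[OF True, of "\<lambda>x. exp x - 1 - x - x\<^sup>2 / 2"])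
    fix y :: real
    have "((\<lambda>x. exp x - 1 - x - x\<^sup>2 / 2) has_real_derivative exp y - 1 - y) (at y)"
      by (auto intro!: derivative_eq_intros)
    then show "\<exists>d. ((\<lambda>x. exp x - 1 - x - x\<^sup>2 / 2) has_real_derivative d) (at y) \<and> 0 \<le> d"
      using exp_ge_add_one_self[of y] by (intro exI[of _ "exp y - 1 - y"] conjI) (assumption, linarith)
  qed
  moreover have "max 1 (exp x) = 1" using True by simp
  ultimately show ?thesis by simp
next
  case False
  obtain s where s: "\<bar>s\<bar> \<le> \<bar>x\<bar>" "exp x = (\<Sum>m<2. x ^ m / fact m) + exp s / fact 2 * x\<^sup>2"
    using Maclaurin_exp_le[of x 2] by blast
  have "exp s * x\<^sup>2 \<le> max 1 (exp x) * x\<^sup>2"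
    using s(1) False by (intro mult_right_mono) auto
  then show ?thesis
    unfolding s(2) by (simp add: numeral_2_eq_2 mult.commute)
qed

lemma truncate_above_le:
  assumes "0 \<le> L"
  shows "truncate_above L y \<le> L" "truncate_above L y \<le> y" "\<bar>truncate_above L y\<bar> \<le> \<bar>y\<bar>"
  using assms by (auto simp: truncate_above_def indicator_def)

lemma measurable_truncate_above [measurable]: "truncate_above L \<in> borel_measurable borel"
  unfolding truncate_above_def[abs_def] by measurable

lemma (in prob_space) integrable_exp_truncate_above:
  assumes [measurable]: "random_variable borel H" and "0 \<le> L" "0 \<le> l"
  shows "integrable M (\<lambda>\<omega>. exp (l * truncate_above L (H \<omega>)))"
  using truncate_above_le(1)[OF \<open>0 \<le> L\<close>] \<open>0 \<le> l\<close>
  by (intro integrable_const_bound[of _ "exp (l * L)"]) (auto intro: mult_left_mono)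

text \<open>The weights in \<^const>\<open>truncated_moment\<close> are those of the quadratic bound on \<open>exp\<close>: \<open>1\<close> for
  nonpositive values and the exponential for positive ones, with \<open>l\<close> increased to \<open>\<eta>\<close> so that one
  constant serves all \<open>l \<le> \<eta>\<close>. Truncation only decreases values because \<open>0 \<le> L\<close>, hence the linear
  term is at most \<open>0\<close>.\<close>

lemma (in prob_space) mgf_truncate_above_le:
  assumes H: "integrable M H" "expectation H \<le> 0"
    and fin: "truncated_moment M H L \<eta> \<noteq> \<infinity>"
    and "0 \<le> L" "0 \<le> l" "l \<le> \<eta>"
  shows "expectation (\<lambda>\<omega>. exp (l * truncate_above L (H \<omega>)))
       \<le> exp (l\<^sup>2 / 2 * enn2real (truncated_moment M H L \<eta>))"
proof -
  have [measurable]: "H \<in> borel_measurable M" using H by simp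
  let ?T = "\<lambda>\<omega>. truncate_above L (H \<omega>)" and ?v = "enn2real (truncated_moment M H L \<eta>)"
  define w where "w = (\<lambda>\<omega>. (?T \<omega>)\<^sup>2 * indicator {..0} (H \<omega>)
       + (?T \<omega>)\<^sup>2 * exp (\<eta> * ?T \<omega>) * indicator {0<..} (H \<omega>))"
  have [measurable]: "w \<in> borel_measurable M" unfolding w_def by measurable
  have w_nonneg: "0 \<le> w \<omega>" for \<omega> unfolding w_def by simp
  have v_def: "truncated_moment M H L \<eta> = (\<integral>\<^sup>+\<omega>. ennreal (w \<omega>) \<partial>M)"
    unfolding truncated_moment_def w_def ..
  have int_w: "integrable M w"
    using fin w_nonneg unfolding v_def by (intro integrableI_nonneg) (auto simp: less_top)
  have int_T: "integrable M ?T"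
    by (rule Bochner_Integration.integrable_bound[OF H(1)]) (use truncate_above_le(3)[OF \<open>0 \<le> L\<close>] in auto)
  have w: "(?T \<omega>)\<^sup>2 * max 1 (exp (l * ?T \<omega>)) \<le> w \<omega>" for \<omega>
  proof (cases "H \<omega> \<le> 0")
    case True
    then have "max 1 (exp (l * ?T \<omega>)) = 1"
      using truncate_above_le(2)[OF \<open>0 \<le> L\<close>, of "H \<omega>"] \<open>0 \<le> l\<close> by (simp add: mult_nonneg_nonpos)
    then show ?thesis using True by (simp add: w_def)
  next
    case False
    then have "0 \<le> ?T \<omega>" by (simp add: truncate_above_def)
    then have "max 1 (exp (l * ?T \<omega>)) \<le> exp (\<eta> * ?T \<omega>)"
      using \<open>0 \<le> l\<close> \<open>l \<le> \<eta>\<close> by (simp add: mult_right_mono)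
    then show ?thesis using False by (simp add: w_def mult_left_mono)
  qed
  have "exp (l * ?T \<omega>) \<le> 1 + l * ?T \<omega> + l\<^sup>2 / 2 * w \<omega>" for \<omega>
  proof -
    have "exp (l * ?T \<omega>) \<le> 1 + l * ?T \<omega> + l\<^sup>2 / 2 * ((?T \<omega>)\<^sup>2 * max 1 (exp (l * ?T \<omega>)))"
      using exp_le_quadratic[of "l * ?T \<omega>"] by (simp add: power_mult_distrib)
    also have "\<dots> \<le> 1 + l * ?T \<omega> + l\<^sup>2 / 2 * w \<omega>"
      by (intro add_left_mono mult_left_mono w) auto
    finally show ?thesis .
  qed
  then have "expectation (\<lambda>\<omega>. exp (l * ?T \<omega>)) \<le> expectation (\<lambda>\<omega>. 1 + l * ?T \<omega> + l\<^sup>2 / 2 * w \<omega>)"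
    using int_T int_w assms(4,5) by (intro integral_mono integrable_exp_truncate_above) auto
  also have "\<dots> = 1 + l * expectation ?T + l\<^sup>2 / 2 * expectation w"
    using int_T int_w by (simp add: prob_space)
  also have "expectation w = ?v"
    unfolding v_def using w_nonneg by (intro integral_eq_nn_integral) auto
  also have "l * expectation ?T \<le> 0"
  proof -
    have "expectation ?T \<le> expectation H"
      by (intro integral_mono int_T H truncate_above_le \<open>0 \<le> L\<close>)
    then show ?thesis using H \<open>0 \<le> l\<close> by (intro mult_nonneg_nonpos) auto
  qed
  also have "1 + 0 + l\<^sup>2 / 2 * ?v \<le> exp (l\<^sup>2 / 2 * ?v)"
    using exp_ge_add_one_self[of "l\<^sup>2 / 2 * ?v"] by simp
  finally show ?thesis by simp
qed

section \<open>Tail bounds\<close>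

lemma (in prob_space) Chernoff_bound:
  assumes "integrable M (\<lambda>\<omega>. exp (s * Y \<omega>))" and [measurable]: "random_variable borel Y" and "0 \<le> s"
  shows "prob {\<omega> \<in> space M. Y \<omega> > a} \<le> exp (- (s * a)) * expectation (\<lambda>\<omega>. exp (s * Y \<omega>))"
proof -
  have "prob {\<omega> \<in> space M. Y \<omega> > a} \<le> prob {\<omega> \<in> space M. exp (s * Y \<omega>) \<ge> exp (s * a)}"
    using \<open>0 \<le> s\<close> by (intro finite_measure_mono) (auto intro: mult_left_mono)
  also have "\<dots> \<le> expectation (\<lambda>\<omega>. exp (s * Y \<omega>)) / exp (s * a)"
    by (rule integral_Markov_inequality_measure[OF assms(1), of "{}"]) auto
  finally show ?thesis by (simp add: exp_minus field_simps)
qed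

text \<open>Chernoff's bound is applied with exponent \<open>l k\<close>, for which the moment generating function of
  the U-statistic is at most the \<open>k\<close>-th power of that of one truncated kernel value at \<open>l\<close>.\<close>

lemma (in prob_space) U_statistic_truncated_tail:
  assumes "1 \<le> m"
    and indep: "indep_vars (\<lambda>_. borel) X {1..n}"
    and ident: "\<And>i. i \<in> {1..n} \<Longrightarrow> distr M borel (X i) = \<mu>"
    and h[measurable]: "h \<in> borel_measurable (Pi\<^sub>M {1..m} (\<lambda>_. borel))"
    and sym: "symmetric_kernel m h"
    and kmn: "k * m \<le> n" "1 \<le> k"
    and H: "integrable M (kernel_rv m h X)" "expectation (kernel_rv m h X) \<le> 0"
    and fin: "truncated_moment M (kernel_rv m h X) L \<eta> \<noteq> \<infinity>"
    and "0 \<le> L" "0 \<le> l" "l \<le> \<eta>"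
  shows "prob {\<omega> \<in> space M. U_statistic n m (truncate_above L \<circ> h) X \<omega> > t}
       \<le> exp (- (real k * (l * t - l\<^sup>2 / 2 * enn2real (truncated_moment M (kernel_rv m h X) L \<eta>))))"
proof -
  let ?g = "truncate_above L \<circ> h" and ?v = "enn2real (truncated_moment M (kernel_rv m h X) L \<eta>)"
  have g: "?g \<in> borel_measurable (Pi\<^sub>M {1..m} (\<lambda>_. borel))" "symmetric_kernel m ?g"
    by measurable (use sym in \<open>simp add: symmetric_kernel_def\<close>)
  have kernel: "kernel_rv m ?g X = (\<lambda>\<omega>. truncate_above L (kernel_rv m h X \<omega>))"
    by (simp add: kernel_rv_def fun_eq_iff)
  have int: "integrable M (\<lambda>\<omega>. exp (l * kernel_rv m ?g X \<omega>))"
    unfolding kernel using H(1) assms(11,12) by (intro integrable_exp_truncate_above) auto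
  note mgf = U_statistic_mgf_le[OF \<open>1 \<le> m\<close> indep ident g kmn int]
  have "prob {\<omega> \<in> space M. U_statistic n m ?g X \<omega> > t}
      \<le> exp (- (l * real k * t)) * expectation (\<lambda>\<omega>. exp (l * real k * U_statistic n m ?g X \<omega>))"
    using \<open>0 \<le> l\<close> by (intro Chernoff_bound mgf measurable_U_statistic[OF indep g(1)]) auto
  also have "\<dots> \<le> exp (- (l * real k * t)) * expectation (\<lambda>\<omega>. exp (l * kernel_rv m ?g X \<omega>)) ^ k"
    by (intro mult_left_mono mgf) auto
  also have "\<dots> \<le> exp (- (l * real k * t)) * exp (l\<^sup>2 / 2 * ?v) ^ k"
    unfolding kernel
    by (intro mult_left_mono power_mono mgf_truncate_above_le[OF H fin] assms) auto
  also have "\<dots> = exp (- (real k * (l * t - l\<^sup>2 / 2 * ?v)))"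
    by (simp add: exp_of_nat_mult[symmetric] exp_add[symmetric] algebra_simps)
  finally show ?thesis .
qed

text \<open>Both U-statistics agree unless some summand exceeds \<open>L\<close>, and all \<open>n choose m\<close> summands have
  the same law.\<close>

lemma (in prob_space) prob_U_statistic_le_truncated:
  assumes "1 \<le> m" "m \<le> n"
    and indep: "indep_vars (\<lambda>_. borel) X {1..n}"
    and ident: "\<And>i. i \<in> {1..n} \<Longrightarrow> distr M borel (X i) = \<mu>"
    and h[measurable]: "h \<in> borel_measurable (Pi\<^sub>M {1..m} (\<lambda>_. borel))"
  shows "prob {\<omega> \<in> space M. U_statistic n m h X \<omega> > t}
       \<le> prob {\<omega> \<in> space M. U_statistic n m (truncate_above L \<circ> h) X \<omega> > t}
         + real (n choose m) * prob {\<omega> \<in> space M. kernel_rv m h X \<omega> > L}"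
proof -
  let ?g = "truncate_above L \<circ> h" and ?T = "increasing_tuples m n"
  define H where "H = (\<lambda>f \<omega>. h (\<lambda>j\<in>{1..m}. X (f j) \<omega>))"
  have H_measurable: "random_variable borel (H f)" if "f ` {1..m} \<subseteq> {1..n}" for f
    unfolding H_def using measurable_compose[OF measurable_subfamily[OF indep that] h] .
  have H_tail: "prob {\<omega> \<in> space M. H f \<omega> > L} = measure (distr (\<Pi>\<^sub>M j\<in>{1..m}. \<mu>) borel h) {L<..}"
    if f: "inj_on f {1..m}" "f ` {1..m} \<subseteq> {1..n}" for f
  proof -
    have "prob {\<omega> \<in> space M. H f \<omega> > L} = measure (distr M borel (H f)) {L<..}"
      using H_measurable[OF f(2)] by (auto simp: measure_distr intro!: arg_cong[of _ _ prob])
    then show ?thesis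
      using kernel_of_iid_subfamily_distr[OF indep ident h f] \<open>1 \<le> m\<close> by (simp add: H_def)
  qed
  have "kernel_rv m h X = H id" by (simp add: kernel_rv_def H_def fun_eq_iff)
  then have tail: "prob {\<omega> \<in> space M. H i \<omega> > L} = prob {\<omega> \<in> space M. kernel_rv m h X \<omega> > L}"
    if "i \<in> ?T" for i
    using H_tail[OF increasing_tuplesD[OF that]] H_tail[of id] \<open>m \<le> n\<close> by simp
  have [measurable]: "random_variable borel (U_statistic n m ?g X)"
    by (rule measurable_U_statistic[OF indep]) measurable
  have U_event: "{\<omega> \<in> space M. U_statistic n m ?g X \<omega> > t} \<in> events"
    by measurable
  have H_event: "{\<omega> \<in> space M. H i \<omega> > L} \<in> events" if "i \<in> ?T" for i
    using H_measurable[OF increasing_tuplesD(2)[OF that]] by auto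
  have union_event: "(\<Union>i\<in>?T. {\<omega> \<in> space M. H i \<omega> > L}) \<in> events"
    using H_event finite_increasing_tuples by (intro sets.finite_UN) auto
  have sub: "{\<omega> \<in> space M. U_statistic n m h X \<omega> > t}
      \<subseteq> {\<omega> \<in> space M. U_statistic n m ?g X \<omega> > t} \<union> (\<Union>i\<in>?T. {\<omega> \<in> space M. H i \<omega> > L})"
  proof
    fix \<omega> assume \<omega>: "\<omega> \<in> {\<omega> \<in> space M. U_statistic n m h X \<omega> > t}"
    show "\<omega> \<in> {\<omega> \<in> space M. U_statistic n m ?g X \<omega> > t} \<union> (\<Union>i\<in>?T. {\<omega> \<in> space M. H i \<omega> > L})"
    proof (cases "\<forall>i\<in>?T. H i \<omega> \<le> L")
      case True
      then have "U_statistic n m ?g X \<omega> = U_statistic n m h X \<omega>"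
        unfolding U_statistic_def by (simp add: H_def truncate_above_def)
      then show ?thesis using \<omega> by simp
    next
      case False
      then show ?thesis using \<omega> by (auto simp: not_le)
    qed
  qed
  have "prob {\<omega> \<in> space M. U_statistic n m h X \<omega> > t}
      \<le> prob ({\<omega> \<in> space M. U_statistic n m ?g X \<omega> > t} \<union> (\<Union>i\<in>?T. {\<omega> \<in> space M. H i \<omega> > L}))"
    by (intro finite_measure_mono sub sets.Un U_event union_event)
  also have "\<dots> \<le> prob {\<omega> \<in> space M. U_statistic n m ?g X \<omega> > t}
      + prob (\<Union>i\<in>?T. {\<omega> \<in> space M. H i \<omega> > L})"
    by (intro measure_Un_le U_event union_event)
  also have "prob (\<Union>i\<in>?T. {\<omega> \<in> space M. H i \<omega> > L}) \<le> (\<Sum>i\<in>?T. prob {\<omega> \<in> space M. H i \<omega> > L})"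
    using H_event by (intro finite_measure_subadditive_finite finite_increasing_tuples) auto
  also have "\<dots> = real (n choose m) * prob {\<omega> \<in> space M. kernel_rv m h X \<omega> > L}"
    using tail by (simp add: card_increasing_tuples)
  finally show ?thesis
    by (simp only: add_left_mono)
qed

text \<open>The concave function \<open>l t - l\<^sup>2 v / 2\<close> is maximised on \<open>[0, \<eta>]\<close> by \<open>min (t / v) \<eta>\<close>, read as
  \<open>\<eta>\<close> if \<open>v = 0\<close>, and each of the two cases is paid for by one summand. In the second case \<open>\<eta> v \<le> t\<close>, so the maximum with
  \<open>1/2\<close> costs nothing.\<close>

lemma Chernoff_exponent_choice:
  fixes v t \<eta> \<kappa> :: real
  assumes "0 \<le> v" "0 < t" "0 \<le> \<eta>" "0 \<le> \<kappa>"
  obtains l where "0 \<le> l" "l \<le> \<eta>"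
    "exp (- (\<kappa> * (l * t - l\<^sup>2 / 2 * v)))
       \<le> (if v = 0 then 0 else exp (- (\<kappa> * t\<^sup>2 / (2 * v))))
         + exp (- (\<kappa> * \<eta> * t * max (1 / 2) (1 - \<eta> * v / (2 * t))))"
proof (cases "t < \<eta> * v")
  case True
  then have "0 < v" using assms by (cases "v = 0") auto
  have "exp (- (\<kappa> * (t / v * t - (t / v)\<^sup>2 / 2 * v))) = exp (- (\<kappa> * t\<^sup>2 / (2 * v)))"
    using \<open>0 < v\<close> by (simp add: field_simps power2_eq_square)
  moreover have "0 \<le> t / v" "t / v \<le> \<eta>"
    using True \<open>0 < v\<close> \<open>0 < t\<close> by (auto simp: divide_le_eq)
  ultimately show thesis
    using that[of "t / v"] \<open>0 < v\<close> by auto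
next
  case False
  have max: "max (1 / 2) (1 - \<eta> * v / (2 * t)) = 1 - \<eta> * v / (2 * t)"
    using False \<open>0 < t\<close> by (simp add: field_simps)
  have "\<kappa> * (\<eta> * t - \<eta>\<^sup>2 / 2 * v) = \<kappa> * \<eta> * t * (1 - \<eta> * v / (2 * t))"
    using \<open>0 < t\<close> by (simp add: field_simps power2_eq_square)
  then show thesis
    using that[of \<eta>] max assms by (auto simp: add_increasing)
qed

theorem theorem2p4:
  fixes M :: "'a measure" and \<mu> :: "real measure"
    and X :: "nat \<Rightarrow> 'a \<Rightarrow> real"
    and h :: "(nat \<Rightarrow> real) \<Rightarrow> real"
    and I :: "real \<Rightarrow> real"
    and m n k :: nat and \<beta> t :: real
  assumes "prob_space M"
    and "m \<ge> 1" and "n \<ge> m"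
    and "prob_space.indep_vars M (\<lambda>_. borel) X {1..n}"
    and "\<And>i. i \<in> {1..n} \<Longrightarrow> distr M borel (X i) = \<mu>"
    and "h \<in> borel_measurable (Pi\<^sub>M {1..m} (\<lambda>_. borel))"
    and "symmetric_kernel m h"
    and "integrable M (kernel_rv m h X)"
    and "(\<integral>\<omega>. kernel_rv m h X \<omega> \<partial>M) = 0"
    and "k = n div m"
    and "\<And>s. s \<ge> 0 \<Longrightarrow> I s \<ge> 0"
    and "mono_on {0..} I"
    and "\<And>s. s \<ge> 0 \<Longrightarrow> measure M {\<omega> \<in> space M. kernel_rv m h X \<omega> > s} \<le> exp (- I s)"
    and "0 < \<beta>" and "\<beta> \<le> 1" and "t > 0"
  shows "let L = real k * t;
             v = truncated_moment M (kernel_rv m h X) L (\<beta> * (I L / L))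
         in measure M {\<omega> \<in> space M. U_statistic n m h X \<omega> > t}
              \<le> gaussian_term k t v
                + exp (- (\<beta> * I L * max_half_c t \<beta> k (I L) v))
                + real (n choose m) * exp (- I L)"
proof -
  interpret prob_space M by fact
  define L where "L = real k * t"
  define \<eta> where "\<eta> = \<beta> * (I L / L)"
  define v where "v = truncated_moment M (kernel_rv m h X) L \<eta>"
  have k: "1 \<le> k" "k * m \<le> n"
    using assms(2,3,10) by (auto simp: Suc_le_eq div_greater_zero_iff)
  have "0 < L" using k \<open>0 < t\<close> by (simp add: L_def)
  then have "0 \<le> \<eta>" using assms(11)[of L] \<open>0 < \<beta>\<close> by (simp add: \<eta>_def)
  have truncated: "prob {\<omega> \<in> space M. U_statistic n m (truncate_above L \<circ> h) X \<omega> > t}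
      \<le> gaussian_term k t v + exp (- (\<beta> * I L * max_half_c t \<beta> k (I L) v))"
  proof (cases "v = \<infinity>")
    case True
    then have "1 \<le> gaussian_term k t v" by (simp add: gaussian_term_def)
    with prob_le_1 show ?thesis
      by (meson add_increasing2 exp_ge_zero order_trans)
  next
    case False
    have zero: "enn2real v = 0 \<longleftrightarrow> v = 0" using False by (simp add: enn2real_eq_0_iff)
    obtain l where l: "0 \<le> l" "l \<le> \<eta>" "exp (- (real k * (l * t - l\<^sup>2 / 2 * enn2real v)))
       \<le> (if enn2real v = 0 then 0 else exp (- (real k * t\<^sup>2 / (2 * enn2real v))))
         + exp (- (real k * \<eta> * t * max (1 / 2) (1 - \<eta> * enn2real v / (2 * t))))"
      by (rule Chernoff_exponent_choice[of "enn2real v" t \<eta> "real k"])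
        (use \<open>0 < t\<close> \<open>0 \<le> \<eta>\<close> in auto)
    have "real k * \<eta> * t = \<beta> * I L"
      using \<open>0 < t\<close> k(1) by (simp add: \<eta>_def L_def)
    moreover have "1 - \<eta> * enn2real v / (2 * t) = c_coeff t \<beta> k (I L) (enn2real v)"
      by (simp add: c_coeff_def \<eta>_def L_def)
    ultimately have "exp (- (real k * (l * t - l\<^sup>2 / 2 * enn2real v)))
        \<le> gaussian_term k t v + exp (- (\<beta> * I L * max_half_c t \<beta> k (I L) v))"
      using l(3) False by (simp add: gaussian_term_def max_half_c_def zero)
    moreover have "prob {\<omega> \<in> space M. U_statistic n m (truncate_above L \<circ> h) X \<omega> > t}
        \<le> exp (- (real k * (l * t - l\<^sup>2 / 2 * enn2real v)))"
      unfolding v_def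
      by (rule U_statistic_truncated_tail)
        (use assms k l \<open>0 < L\<close> False in \<open>auto simp: v_def\<close>)
    ultimately show ?thesis by simp
  qed
  have "prob {\<omega> \<in> space M. U_statistic n m h X \<omega> > t}
      \<le> prob {\<omega> \<in> space M. U_statistic n m (truncate_above L \<circ> h) X \<omega> > t}
        + real (n choose m) * prob {\<omega> \<in> space M. kernel_rv m h X \<omega> > L}"
    by (rule prob_U_statistic_le_truncated) (use assms in auto)
  also have "\<dots> \<le> gaussian_term k t v + exp (- (\<beta> * I L * max_half_c t \<beta> k (I L) v))
      + real (n choose m) * exp (- I L)"
    using assms(13)[of L] \<open>0 < L\<close> by (intro add_mono truncated mult_left_mono) auto
  finally show ?thesis
    by (simp add: Let_def L_def v_def \<eta>_def)
qed

end
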